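(* Let $\hat\gamma:2\pi\mathbb{T}\to(0,\infty)$ be of class $C^2$ and satisfy $3\hat\gamma(\theta)-\hat\gamma(\theta-\pi)\ge0$ for all $\theta\in2\pi\mathbb{T}$. Then for sufficiently large $k$ the following local energy estimate holds. That is, there is a function $K:2\pi\mathbb{T}\to[0,\infty)$ depending only on $\hat\gamma$ such that for every $k:2\pi\mathbb{T}\to\mathbb{R}_{\ge0}$ with $k(\theta)\ge K(\theta)$ for all $\theta$, and for all $\boldsymbol p,\boldsymbol q\in\mathbb{R}^2\setminus\{\boldsymbol 0\}$, written as $\boldsymbol p=|\boldsymbol p|(\cos\varphi,\sin\varphi)^T$ and $\boldsymbol q=|\boldsymbol q|(\cos\theta,\sin\theta)^T$, $$\frac{1}{|\boldsymbol q|}\bigl(\hat{\boldsymbol Z}_k(\theta)\boldsymbol p\bigr)\cdot(\boldsymbol p-\boldsymbol q)\ \ge\ \hat\gamma(\varphi)|\boldsymbol p|-\hat\gamma(\theta)|\boldsymbol q|.$$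
   Context: $2\pi\mathbb{T}=\mathbb{R}/2\pi\mathbb{Z}$; functions on it are $2\pi$-periodic functions on $\mathbb{R}$. For $k:2\pi\mathbb{T}\to\mathbb{R}_{\ge0}$ the symmetric surface energy matrix is $$\hat{\boldsymbol Z}_k(\theta)=\begin{pmatrix}\hat\gamma(\theta)-\hat\gamma'(\theta)\sin2\theta&\hat\gamma'(\theta)\cos2\theta\\ \hat\gamma'(\theta)\cos2\theta&\hat\gamma(\theta)+\hat\gamma'(\theta)\sin2\theta\end{pmatrix}+k(\theta)\begin{pmatrix}\sin^2\theta&-\cos\theta\sin\theta\\-\cos\theta\sin\theta&\cos^2\theta\end{pmatrix}.$$ Here $|\cdot|$ and $\cdot$ denote the Euclidean norm and inner product on $\mathbb{R}^2$. *)

theory Defs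
  imports "HOL-Analysis.Analysis"
begin

text \<open>A function on the torus \<open>\<real>/2\<pi>\<int>\<close> is represented by a \<open>2\<pi>\<close>-periodic function on
  the real line, so that its derivative is the ordinary one.\<close>

abbreviation torus_fun :: "(real \<Rightarrow> real) \<Rightarrow> bool"
  where "torus_fun f \<equiv> periodic_fun_simple f (2 * pi)"

definition C2_fun :: "(real \<Rightarrow> real) \<Rightarrow> bool"
  where "C2_fun f \<longleftrightarrow> f differentiable_on UNIV \<and> deriv f C1_differentiable_on UNIV"

definition surface_energy_matrix ::
    "(real \<Rightarrow> real) \<Rightarrow> (real \<Rightarrow> real) \<Rightarrow> real \<Rightarrow> real^2^2"
  where "surface_energy_matrix \<gamma> k \<theta> =
    vector [vector [\<gamma> \<theta> - deriv \<gamma> \<theta> * sin (2 * \<theta>), deriv \<gamma> \<theta> * cos (2 * \<theta>)],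
            vector [deriv \<gamma> \<theta> * cos (2 * \<theta>), \<gamma> \<theta> + deriv \<gamma> \<theta> * sin (2 * \<theta>)]]
    + k \<theta> *\<^sub>R
      vector [vector [(sin \<theta>)\<^sup>2, - cos \<theta> * sin \<theta>],
              vector [- cos \<theta> * sin \<theta>, (cos \<theta>)\<^sup>2]]"

end

theory Submission
  imports Defs
begin

text \<open>
  Put \<open>a = |p|\<close>, \<open>b = |q|\<close>, \<open>\<delta> = \<phi> - \<theta>\<close>. The matrix is built so that
  \<open>Z p \<bullet> p = a\<^sup>2 (\<gamma> \<theta> + \<gamma>' \<theta> sin 2\<delta> + k \<theta> sin\<^sup>2 \<delta>)\<close> and
  \<open>Z p \<bullet> q = a b (\<gamma> \<theta> cos \<delta> + \<gamma>' \<theta> sin \<delta>)\<close>, where the stabilising term drops out of the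
  second form because it annihilates \<open>q\<close>. After multiplication by \<open>b\<close> the estimate says that a
  quadratic form in \<open>(a, b)\<close> is nonnegative, so it is enough that its discriminant is not positive
  (lemma \<open>energy_estimate_if_discriminant\<close>). That condition has the form
  \<open>D(\<phi>) \<le> 4 \<gamma>(\<theta>) k(\<theta>) sin\<^sup>2 (\<phi> - \<theta>)\<close>, where \<open>D\<close> is the discriminant for \<open>k = 0\<close>. For fixed
  \<open>\<theta>\<close> a large \<open>k(\<theta>)\<close> exists as soon as \<open>D / sin\<^sup>2 (\<phi> - \<theta>)\<close> is bounded above on one period.

  By compactness this is a local question, and only the zeros \<open>\<phi> = \<theta>\<close> and \<open>\<phi> = \<theta> + \<pi>\<close> of the sine
  matter. At \<open>\<phi> = \<theta>\<close> both \<open>D\<close> and its derivative vanish, so \<open>D\<close> is quadratically small there, as is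
  \<open>sin\<^sup>2\<close>. At \<open>\<phi> = \<theta> + \<pi>\<close> the hypothesis \<open>\<gamma>(\<theta> - \<pi>) \<le> 3 \<gamma>(\<theta>)\<close> is exactly \<open>D \<le> 0\<close>. If the
  inequality is strict, \<open>D\<close> is negative nearby. If equality holds, then \<open>\<theta>\<close> minimises
  \<open>x \<mapsto> 3 \<gamma>(x) - \<gamma>(x - \<pi>)\<close>, so \<open>\<gamma>'(\<theta> + \<pi>) = 3 \<gamma>'(\<theta>)\<close>, and this is what makes the derivative of \<open>D\<close>
  vanish too (lemma \<open>zero_discriminant_at_antipode\<close>).
\<close>

section \<open>Domination of a function by a square on a compact set\<close>

lemma compact_locally_dominated:
  fixes f s :: "'a::topological_space \<Rightarrow> real"
  assumes S: "compact S"
    and loc: "\<And>x. x \<in> S \<Longrightarrow> \<exists>C. \<forall>\<^sub>F y in nhds x. f y \<le> C * s y"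
    and s: "\<And>x. 0 \<le> s x"
  shows "\<exists>C\<ge>0. \<forall>x\<in>S. f x \<le> C * s x"
proof -
  have "\<exists>C U. open U \<and> x \<in> U \<and> (\<forall>y\<in>U. f y \<le> C * s y)" if "x \<in> S" for x
    using loc[OF that] unfolding eventually_nhds by metis
  then obtain C U where CU: "\<And>x. x \<in> S \<Longrightarrow> open (U x) \<and> x \<in> U x \<and> (\<forall>y\<in>U x. f y \<le> C x * s y)"
    by metis
  obtain T where T: "T \<subseteq> S" "finite T" "S \<subseteq> (\<Union>x\<in>T. U x)"
    by (rule compactE_image[OF S, of S U]) (use CU in auto)
  define M where "M = Max (insert 0 (C ` T))"
  have M: "0 \<le> M" "\<And>x. x \<in> T \<Longrightarrow> C x \<le> M"
    using T(2) by (auto simp: M_def)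
  have "f y \<le> M * s y" if y: "y \<in> S" for y
  proof -
    obtain x where x: "x \<in> T" "y \<in> U x" using T(3) y by auto
    then have "f y \<le> C x * s y" using CU T(1) by blast
    also have "\<dots> \<le> M * s y" using M(2)[OF x(1)] s by (rule mult_right_mono)
    finally show ?thesis .
  qed
  with M(1) show ?thesis by blast
qed

lemma deriv_ratio_eventually_bounded:
  fixes f :: "real \<Rightarrow> real"
  assumes "(f has_real_derivative D) (at c)" "f c = 0"
  shows "\<forall>\<^sub>F x in nhds c. \<bar>f x\<bar> \<le> (\<bar>D\<bar> + 1) * \<bar>x - c\<bar>"
proof -
  have "((\<lambda>x. \<bar>f x / (x - c)\<bar>) \<longlongrightarrow> \<bar>D\<bar>) (at c)"
    using assms by (intro tendsto_rabs) (simp add: has_field_derivative_iff)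
  then have "\<forall>\<^sub>F x in at c. \<bar>f x / (x - c)\<bar> < \<bar>D\<bar> + 1"
    by (rule order_tendstoD) simp
  then have "\<forall>\<^sub>F x in at c. \<bar>f x\<bar> \<le> (\<bar>D\<bar> + 1) * \<bar>x - c\<bar>"
    unfolding eventually_at_filter by eventually_elim (auto simp: abs_divide field_simps)
  then show ?thesis
    using assms(2) by (simp add: eventually_nhds_conv_at)
qed

text \<open>A double zero gives a quadratic bound: the derivative grows at most linearly away from \<open>c\<close>,
  and the mean value theorem integrates this once.\<close>

lemma double_zero_quadratic_bound:
  fixes f f' :: "real \<Rightarrow> real"
  assumes f: "\<And>x. (f has_real_derivative f' x) (at x)"
    and f': "(f' has_real_derivative D) (at c)"
    and zero: "f c = 0" "f' c = 0"
  shows "\<forall>\<^sub>F x in nhds c. \<bar>f x\<bar> \<le> (\<bar>D\<bar> + 1) * (x - c)\<^sup>2"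
proof -
  obtain d where d: "d > 0" "\<And>x. dist x c < d \<Longrightarrow> \<bar>f' x\<bar> \<le> (\<bar>D\<bar> + 1) * \<bar>x - c\<bar>"
    using deriv_ratio_eventually_bounded[OF f' zero(2)] unfolding eventually_nhds_metric by blast
  have "\<bar>f x\<bar> \<le> (\<bar>D\<bar> + 1) * (x - c)\<^sup>2" if x: "dist x c < d" for x
  proof (cases "x = c")
    case False
    obtain z where z: "\<bar>z - c\<bar> \<le> \<bar>x - c\<bar>" "f x - f c = (x - c) * f' z"
    proof (cases "x < c")
      case True
      from MVT2[OF this f] obtain z where "x < z" "z < c" "f c - f x = (c - x) * f' z" by blast
      then show thesis using that[of z] by (simp add: algebra_simps)
    next
      case False
      with \<open>x \<noteq> c\<close> have "c < x" by simp
      from MVT2[OF this f] obtain z where "c < z" "z < x" "f x - f c = (x - c) * f' z" by blast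
      then show thesis using that[of z] by simp
    qed
    have "\<bar>f' z\<bar> \<le> (\<bar>D\<bar> + 1) * \<bar>z - c\<bar>"
      using z(1) x by (intro d(2)) (simp add: dist_real_def)
    also have "\<dots> \<le> (\<bar>D\<bar> + 1) * \<bar>x - c\<bar>"
      using z(1) by (intro mult_left_mono) auto
    finally have "\<bar>x - c\<bar> * \<bar>f' z\<bar> \<le> \<bar>x - c\<bar> * ((\<bar>D\<bar> + 1) * \<bar>x - c\<bar>)"
      by (intro mult_left_mono) auto
    moreover have "\<bar>f x\<bar> = \<bar>x - c\<bar> * \<bar>f' z\<bar>"
      using z(2) zero(1) by (simp add: abs_mult)
    moreover have "\<bar>x - c\<bar> * ((\<bar>D\<bar> + 1) * \<bar>x - c\<bar>) = (\<bar>D\<bar> + 1) * (x - c)\<^sup>2"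
      by (simp add: power2_eq_square)
    ultimately show ?thesis by simp
  qed (simp add: zero)
  with d(1) show ?thesis unfolding eventually_nhds_metric by blast
qed

lemma simple_zero_linear_lower_bound:
  fixes s :: "real \<Rightarrow> real"
  assumes s: "(s has_real_derivative m) (at c)" and "s c = 0" and m: "m \<noteq> 0"
  shows "\<forall>\<^sub>F x in nhds c. \<bar>x - c\<bar> \<le> 2 / \<bar>m\<bar> * \<bar>s x\<bar>"
proof -
  have "((\<lambda>x. \<bar>s x / (x - c)\<bar>) \<longlongrightarrow> \<bar>m\<bar>) (at c)"
    using assms by (intro tendsto_rabs) (simp add: has_field_derivative_iff)
  then have "\<forall>\<^sub>F x in at c. \<bar>m\<bar> / 2 < \<bar>s x / (x - c)\<bar>"
    by (rule order_tendstoD) (use m in simp)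
  then have "\<forall>\<^sub>F x in at c. \<bar>x - c\<bar> \<le> 2 / \<bar>m\<bar> * \<bar>s x\<bar>"
    unfolding eventually_at_filter
    by eventually_elim (use m in \<open>auto simp: abs_divide field_simps\<close>)
  then show ?thesis
    by (simp add: eventually_nhds_conv_at)
qed

text \<open>At a zero of \<open>s\<close> the function \<open>f\<close> is either negative, hence trivially dominated, or it has a
  double zero while \<open>s\<close> has a simple one.\<close>

lemma dominated_by_square_on_compact:
  fixes f f' s s' :: "real \<Rightarrow> real"
  assumes S: "compact S"
    and f: "\<And>x. (f has_real_derivative f' x) (at x)"
    and f': "\<And>x. f' differentiable (at x)"
    and s: "\<And>x. (s has_real_derivative s' x) (at x)"
    and simple: "\<And>x. x \<in> S \<Longrightarrow> s x = 0 \<Longrightarrow> s' x \<noteq> 0"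
    and nonpos: "\<And>x. x \<in> S \<Longrightarrow> s x = 0 \<Longrightarrow> f x \<le> 0"
    and double: "\<And>x. x \<in> S \<Longrightarrow> s x = 0 \<Longrightarrow> f x = 0 \<Longrightarrow> f' x = 0"
  shows "\<exists>C\<ge>0. \<forall>x\<in>S. f x \<le> C * (s x)\<^sup>2"
proof (rule compact_locally_dominated[OF S])
  fix c assume c: "c \<in> S"
  have cont: "(f \<longlongrightarrow> f c) (nhds c)" "(s \<longlongrightarrow> s c) (nhds c)"
    using DERIV_isCont[OF f[of c]] DERIV_isCont[OF s[of c]]
    by (simp_all add: isCont_def tendsto_at_iff_tendsto_nhds)
  consider "s c \<noteq> 0" | "s c = 0" "f c < 0" | "s c = 0" "f c = 0"
    using nonpos[OF c] by fastforce
  then show "\<exists>C. \<forall>\<^sub>F y in nhds c. f y \<le> C * (s y)\<^sup>2"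
  proof cases
    case 1
    have "((\<lambda>x. f x / (s x)\<^sup>2) \<longlongrightarrow> f c / (s c)\<^sup>2) (nhds c)"
      using 1 by (intro tendsto_intros cont) auto
    then have "\<forall>\<^sub>F x in nhds c. f x / (s x)\<^sup>2 < f c / (s c)\<^sup>2 + 1"
      by (rule order_tendstoD) simp
    moreover have "\<forall>\<^sub>F x in nhds c. s x \<noteq> 0"
      using 1 cont(2) by (rule tendsto_imp_eventually_ne[rotated])
    ultimately have "\<forall>\<^sub>F x in nhds c. f x \<le> (f c / (s c)\<^sup>2 + 1) * (s x)\<^sup>2"
    proof eventually_elim
      case (elim x)
      then have "f x / (s x)\<^sup>2 * (s x)\<^sup>2 \<le> (f c / (s c)\<^sup>2 + 1) * (s x)\<^sup>2"
        by (intro mult_right_mono) auto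
      then show ?case using elim by simp
    qed
    then show ?thesis by blast
  next
    case 2
    then have "\<forall>\<^sub>F x in nhds c. f x < 0"
      using cont(1) by (intro order_tendstoD)
    then have "\<forall>\<^sub>F x in nhds c. f x \<le> 0 * (s x)\<^sup>2"
      by eventually_elim simp
    then show ?thesis by blast
  next
    case 3
    obtain D where D: "(f' has_real_derivative D) (at c)"
      using f' real_differentiableE by blast
    have m: "s' c \<noteq> 0" using simple[OF c] 3 by blast
    have "\<forall>\<^sub>F x in nhds c. \<bar>f x\<bar> \<le> (\<bar>D\<bar> + 1) * (x - c)\<^sup>2"
      using f D 3(2) double[OF c 3] by (rule double_zero_quadratic_bound)
    moreover have "\<forall>\<^sub>F x in nhds c. \<bar>x - c\<bar> \<le> 2 / \<bar>s' c\<bar> * \<bar>s x\<bar>"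
      using s 3(1) m by (rule simple_zero_linear_lower_bound)
    ultimately have "\<forall>\<^sub>F x in nhds c. f x \<le> ((\<bar>D\<bar> + 1) * (2 / \<bar>s' c\<bar>)\<^sup>2) * (s x)\<^sup>2"
    proof eventually_elim
      case (elim x)
      have "\<bar>x - c\<bar>\<^sup>2 \<le> (2 / \<bar>s' c\<bar> * \<bar>s x\<bar>)\<^sup>2"
        using elim(2) by (rule power_mono) simp
      then have "(x - c)\<^sup>2 \<le> (2 / \<bar>s' c\<bar>)\<^sup>2 * (s x)\<^sup>2"
        unfolding power_mult_distrib by simp
      then have "(\<bar>D\<bar> + 1) * (x - c)\<^sup>2 \<le> (\<bar>D\<bar> + 1) * ((2 / \<bar>s' c\<bar>)\<^sup>2 * (s x)\<^sup>2)"
        by (intro mult_left_mono) auto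
      then show ?case using elim(1) by (simp add: mult.assoc)
    qed
    then show ?thesis by blast
  qed
qed simp

section \<open>The discriminant of the energy form\<close>

text \<open>The discriminant, for \<open>k = 0\<close>, of the quadratic form in \<open>(|p|, |q|)\<close> that is left when the
  energy estimate is multiplied by \<open>|q|\<close>.\<close>

definition energy_discriminant :: "(real \<Rightarrow> real) \<Rightarrow> real \<Rightarrow> real \<Rightarrow> real"
  where "energy_discriminant \<gamma> \<theta> \<phi> =
    (\<gamma> \<theta> * cos (\<phi> - \<theta>) + deriv \<gamma> \<theta> * sin (\<phi> - \<theta>) + \<gamma> \<phi>)\<^sup>2
    - 4 * \<gamma> \<theta> * (\<gamma> \<theta> + deriv \<gamma> \<theta> * sin (2 * (\<phi> - \<theta>)))"

definition energy_discriminant_deriv :: "(real \<Rightarrow> real) \<Rightarrow> real \<Rightarrow> real \<Rightarrow> real"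
  where "energy_discriminant_deriv \<gamma> \<theta> \<phi> =
    2 * (\<gamma> \<theta> * cos (\<phi> - \<theta>) + deriv \<gamma> \<theta> * sin (\<phi> - \<theta>) + \<gamma> \<phi>)
      * (deriv \<gamma> \<phi> + deriv \<gamma> \<theta> * cos (\<phi> - \<theta>) - \<gamma> \<theta> * sin (\<phi> - \<theta>))
    - 8 * \<gamma> \<theta> * deriv \<gamma> \<theta> * cos (2 * (\<phi> - \<theta>))"

lemma quadratic_form_nonneg_if_discriminant:
  fixes A B C a b :: real
  assumes C: "0 < C" and disc: "B\<^sup>2 \<le> 4 * C * A"
  shows "0 \<le> A * a\<^sup>2 - B * a * b + C * b\<^sup>2"
proof -
  have "0 \<le> (4 * C * A - B\<^sup>2) * a\<^sup>2 + (2 * C * b - B * a)\<^sup>2"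
    using disc by simp
  also have "\<dots> = 4 * C * (A * a\<^sup>2 - B * a * b + C * b\<^sup>2)"
    by (simp add: power2_eq_square algebra_simps)
  finally show ?thesis
    using C by (simp add: zero_le_mult_iff)
qed

lemma surface_energy_matrix_forms:
  fixes a b :: real
  defines "m \<equiv> \<lambda>t. vector [cos t, sin t] :: real^2"
  shows "(surface_energy_matrix \<gamma> k \<theta> *v (a *\<^sub>R m \<phi>)) \<bullet> (a *\<^sub>R m \<phi> - b *\<^sub>R m \<theta>) =
     a\<^sup>2 * (\<gamma> \<theta> + deriv \<gamma> \<theta> * sin (2 * (\<phi> - \<theta>)) + k \<theta> * (sin (\<phi> - \<theta>))\<^sup>2)
     - a * b * (\<gamma> \<theta> * cos (\<phi> - \<theta>) + deriv \<gamma> \<theta> * sin (\<phi> - \<theta>))"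
proof -
  define c s C S where "c = cos \<theta>" and "s = sin \<theta>" and "C = cos \<phi>" and "S = sin \<phi>"
  have cs: "c * c + s * s = 1" and CS: "C * C + S * S = 1"
    by (simp_all add: c_def s_def C_def S_def flip: power2_eq_square)
  define g h where "g = \<gamma> \<theta>" and "h = deriv \<gamma> \<theta>"
  have trig: "sin (\<phi> - \<theta>) = S * c - C * s" "cos (\<phi> - \<theta>) = C * c + S * s"
    "sin (2 * (\<phi> - \<theta>)) = 2 * (S * c - C * s) * (C * c + S * s)"
    "sin (2 * \<theta>) = 2 * s * c" "cos (2 * \<theta>) = c * c - s * s"
    by (simp_all only: sin_double cos_double sin_diff cos_diff power2_eq_square
        c_def s_def C_def S_def)
  have "(surface_energy_matrix \<gamma> k \<theta> *v (a *\<^sub>R m \<phi>)) \<bullet> (a *\<^sub>R m \<phi> - b *\<^sub>R m \<theta>)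
     = ((g - h * (2 * s * c) + k \<theta> * (s * s)) * (a * C)
         + (h * (c * c - s * s) - k \<theta> * (c * s)) * (a * S)) * (a * C - b * c)
     + ((h * (c * c - s * s) - k \<theta> * (c * s)) * (a * C)
         + (g + h * (2 * s * c) + k \<theta> * (c * c)) * (a * S)) * (a * S - b * s)"
    unfolding surface_energy_matrix_def m_def trig g_def [symmetric] h_def [symmetric]
    by (simp add: matrix_vector_mult_def inner_vec_def sum_2 power2_eq_square
        flip: c_def s_def C_def S_def)
  also have "\<dots> = a\<^sup>2 * (g + h * (2 * (S * c - C * s) * (C * c + S * s)) + k \<theta> * (S * c - C * s)\<^sup>2)
     - a * b * (g * (C * c + S * s) + h * (S * c - C * s))"
    using cs CS by algebra
  finally show ?thesis
    unfolding trig g_def h_def .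
qed

lemma energy_estimate_if_discriminant:
  fixes p q :: "real^2"
  assumes pos: "0 < \<gamma> \<theta>"
    and disc: "energy_discriminant \<gamma> \<theta> \<phi> \<le> 4 * \<gamma> \<theta> * k \<theta> * (sin (\<phi> - \<theta>))\<^sup>2"
    and q: "q \<noteq> 0"
    and p_polar: "p = norm p *\<^sub>R vector [cos \<phi>, sin \<phi>]"
    and q_polar: "q = norm q *\<^sub>R vector [cos \<theta>, sin \<theta>]"
  shows "\<gamma> \<phi> * norm p - \<gamma> \<theta> * norm q
    \<le> 1 / norm q * ((surface_energy_matrix \<gamma> k \<theta> *v p) \<bullet> (p - q))"
proof -
  define a b where "a = norm p" and "b = norm q"
  define A where "A = \<gamma> \<theta> + deriv \<gamma> \<theta> * sin (2 * (\<phi> - \<theta>)) + k \<theta> * (sin (\<phi> - \<theta>))\<^sup>2"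
  define B where "B = \<gamma> \<theta> * cos (\<phi> - \<theta>) + deriv \<gamma> \<theta> * sin (\<phi> - \<theta>)"
  have b: "0 < b" using q by (simp add: b_def)
  have form: "(surface_energy_matrix \<gamma> k \<theta> *v p) \<bullet> (p - q) = a\<^sup>2 * A - a * b * B"
    by (subst p_polar, subst (2) p_polar, subst q_polar)
       (simp only: surface_energy_matrix_forms A_def B_def a_def b_def)
  have "(B + \<gamma> \<phi>)\<^sup>2 \<le> 4 * \<gamma> \<theta> * A"
    using disc by (simp add: energy_discriminant_def A_def B_def algebra_simps)
  then have "0 \<le> A * a\<^sup>2 - (B + \<gamma> \<phi>) * a * b + \<gamma> \<theta> * b\<^sup>2"
    by (rule quadratic_form_nonneg_if_discriminant[OF pos])
  then have "(\<gamma> \<phi> * a - \<gamma> \<theta> * b) * b \<le> a\<^sup>2 * A - a * b * B"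
    by (simp add: algebra_simps power2_eq_square)
  then have "\<gamma> \<phi> * a - \<gamma> \<theta> * b \<le> (a\<^sup>2 * A - a * b * B) / b"
    using b by (simp add: pos_le_divide_eq)
  then show ?thesis
    unfolding form by (simp add: a_def b_def)
qed

lemma DERIV_energy_discriminant:
  assumes "(\<gamma> has_real_derivative deriv \<gamma> \<phi>) (at \<phi>)"
  shows "(energy_discriminant \<gamma> \<theta> has_real_derivative energy_discriminant_deriv \<gamma> \<theta> \<phi>) (at \<phi>)"
  unfolding energy_discriminant_def [abs_def] energy_discriminant_deriv_def
  by (rule derivative_eq_intros assms refl | simp add: algebra_simps)+

lemma energy_discriminant_deriv_differentiable:
  fixes \<gamma> :: "real \<Rightarrow> real"
  assumes "\<gamma> differentiable (at \<phi>)" "deriv \<gamma> differentiable (at \<phi>)"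
  shows "energy_discriminant_deriv \<gamma> \<theta> differentiable (at \<phi>)"
proof -
  obtain d1 d2 where "(\<gamma> has_real_derivative d1) (at \<phi>)" "(deriv \<gamma> has_real_derivative d2) (at \<phi>)"
    using assms real_differentiableE by metis
  then have "\<exists>D. (energy_discriminant_deriv \<gamma> \<theta> has_real_derivative D) (at \<phi>)"
    unfolding energy_discriminant_deriv_def [abs_def]
    by (intro exI) (rule derivative_eq_intros refl | assumption)+
  then show ?thesis
    using real_differentiable_def by blast
qed

text \<open>A zero of the nonnegative function \<open>3 \<gamma> x - \<gamma> (x + \<pi>)\<close> is a minimum, so the derivative
  vanishes there.\<close>

lemma antipodal_equality_deriv:
  fixes \<gamma> :: "real \<Rightarrow> real"
  assumes d: "\<And>x. (\<gamma> has_real_derivative deriv \<gamma> x) (at x)"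
    and ineq: "\<And>x. \<gamma> (x + pi) \<le> 3 * \<gamma> x"
    and eq: "\<gamma> (\<theta> + pi) = 3 * \<gamma> \<theta>"
  shows "deriv \<gamma> (\<theta> + pi) = 3 * deriv \<gamma> \<theta>"
proof -
  have "((\<lambda>x. \<gamma> (x + pi)) has_real_derivative deriv \<gamma> (\<theta> + pi)) (at \<theta>)"
    using d[of "\<theta> + pi"] by (simp add: DERIV_shift)
  then have "((\<lambda>x. 3 * \<gamma> x - \<gamma> (x + pi)) has_real_derivative 3 * deriv \<gamma> \<theta> - deriv \<gamma> (\<theta> + pi)) (at \<theta>)"
    by (intro DERIV_diff DERIV_cmult d)
  moreover have "\<forall>y. \<bar>\<theta> - y\<bar> < 1 \<longrightarrow> 3 * \<gamma> \<theta> - \<gamma> (\<theta> + pi) \<le> 3 * \<gamma> y - \<gamma> (y + pi)"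
    using ineq eq by simp
  ultimately have "3 * deriv \<gamma> \<theta> - deriv \<gamma> (\<theta> + pi) = 0"
    using DERIV_local_min[OF _ zero_less_one] by blast
  then show ?thesis by simp
qed

lemma discriminant_nonpos_at_antipode:
  assumes "0 < \<gamma> \<theta>" "0 < \<gamma> (\<theta> + pi)" "\<gamma> (\<theta> + pi) \<le> 3 * \<gamma> \<theta>"
  shows "energy_discriminant \<gamma> \<theta> (\<theta> + pi) \<le> 0"
proof -
  have "\<bar>\<gamma> (\<theta> + pi) - \<gamma> \<theta>\<bar> \<le> \<bar>2 * \<gamma> \<theta>\<bar>"
    using assms by linarith
  then have "(\<gamma> (\<theta> + pi) - \<gamma> \<theta>)\<^sup>2 \<le> (2 * \<gamma> \<theta>)\<^sup>2"
    by (simp only: abs_le_square_iff)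
  then show ?thesis
    by (simp add: energy_discriminant_def power2_eq_square algebra_simps)
qed

text \<open>At the antipode the discriminant equals \<open>(\<gamma>(\<theta> + \<pi>) - 3 \<gamma> \<theta>) (\<gamma>(\<theta> + \<pi>) + \<gamma> \<theta>)\<close>, so it vanishes
  only in the equality case of the hypothesis on \<open>\<gamma>\<close>.\<close>

lemma zero_discriminant_at_antipode:
  fixes \<gamma> :: "real \<Rightarrow> real"
  assumes d: "\<And>x. (\<gamma> has_real_derivative deriv \<gamma> x) (at x)"
    and pos: "\<And>x. 0 < \<gamma> x"
    and ineq: "\<And>x. \<gamma> (x + pi) \<le> 3 * \<gamma> x"
    and zero: "energy_discriminant \<gamma> \<theta> (\<theta> + pi) = 0"
  shows "energy_discriminant_deriv \<gamma> \<theta> (\<theta> + pi) = 0"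
proof -
  have "(\<gamma> (\<theta> + pi) - 3 * \<gamma> \<theta>) * (\<gamma> (\<theta> + pi) + \<gamma> \<theta>) = 0"
    using zero by (simp add: energy_discriminant_def power2_eq_square algebra_simps)
  moreover have "\<gamma> (\<theta> + pi) + \<gamma> \<theta> \<noteq> 0"
    using pos[of \<theta>] pos[of "\<theta> + pi"] by linarith
  ultimately have eq: "\<gamma> (\<theta> + pi) = 3 * \<gamma> \<theta>" by simp
  have "deriv \<gamma> (\<theta> + pi) = 3 * deriv \<gamma> \<theta>"
    using d ineq eq by (rule antipodal_equality_deriv)
  then show ?thesis
    using eq by (simp add: energy_discriminant_deriv_def)
qed

section \<open>Existence of the stabilising function\<close>

lemma deriv_torus_fun:
  fixes \<gamma> :: "real \<Rightarrow> real"
  assumes per: "torus_fun \<gamma>" and d: "\<And>x. (\<gamma> has_real_derivative deriv \<gamma> x) (at x)"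
  shows "torus_fun (deriv \<gamma>)"
proof
  fix x
  have "((\<lambda>y. \<gamma> (y + 2 * pi)) has_real_derivative deriv \<gamma> (x + 2 * pi)) (at x)"
    using d[of "x + 2 * pi"] by (simp add: DERIV_shift)
  then show "deriv \<gamma> (x + 2 * pi) = deriv \<gamma> x"
    using DERIV_imp_deriv by (fastforce simp: periodic_fun_simple.plus_period[OF per])
qed

lemma energy_discriminant_periodic:
  assumes "torus_fun \<gamma>" "torus_fun (deriv \<gamma>)"
  shows "energy_discriminant \<gamma> \<theta> (\<phi> + 2 * pi) = energy_discriminant \<gamma> \<theta> \<phi>"
    and "energy_discriminant \<gamma> (\<theta> + 2 * pi) \<phi> = energy_discriminant \<gamma> \<theta> \<phi>"
proof -
  have shift: "x + 2 * pi - y = (x - y) + 2 * pi" "y - (x + 2 * pi) = (y - x) - 2 * pi"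
    "2 * ((x - y) + 2 * pi) = 2 * (x - y) + 2 * pi + 2 * pi"
    "2 * ((y - x) - 2 * pi) = 2 * (y - x) - 2 * pi - 2 * pi" for x y :: real
    by simp_all
  have minus_period: "sin (x - 2 * pi) = sin x" "cos (x - 2 * pi) = cos x" for x :: real
    by (simp_all add: sin_diff cos_diff)
  note per = periodic_fun_simple.plus_period[OF assms(1)] periodic_fun_simple.plus_period[OF assms(2)]
    sin_periodic cos_periodic minus_period
  show "energy_discriminant \<gamma> \<theta> (\<phi> + 2 * pi) = energy_discriminant \<gamma> \<theta> \<phi>"
    "energy_discriminant \<gamma> (\<theta> + 2 * pi) \<phi> = energy_discriminant \<gamma> \<theta> \<phi>"
    unfolding energy_discriminant_def shift per by (rule refl)+
qed

lemma torus_fun_bound_from_period: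
  assumes F: "torus_fun F" and G: "torus_fun G"
    and le: "\<And>x. x \<in> {a..a + 2 * pi} \<Longrightarrow> F x \<le> G x"
  shows "F x \<le> G x"
proof -
  interpret F: periodic_fun_simple F "2 * pi" by (rule F)
  interpret G: periodic_fun_simple G "2 * pi" by (rule G)
  define n where "n = \<lfloor>(x - a) / (2 * pi)\<rfloor>"
  have "of_int n \<le> (x - a) / (2 * pi)" "(x - a) / (2 * pi) \<le> of_int n + 1"
    unfolding n_def by linarith+
  then have "x - of_int n * (2 * pi) \<in> {a..a + 2 * pi}"
    by (auto simp: field_simps)
  from le[OF this] show ?thesis
    by (simp only: F.minus_of_int G.minus_of_int)
qed

lemma energy_discriminant_dominated:
  fixes \<gamma> :: "real \<Rightarrow> real"
  assumes per: "torus_fun \<gamma>"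
    and pos: "\<And>x. 0 < \<gamma> x"
    and d: "\<And>x. (\<gamma> has_real_derivative deriv \<gamma> x) (at x)"
    and d2: "\<And>x. deriv \<gamma> differentiable (at x)"
    and ineq: "\<And>x. \<gamma> (x + pi) \<le> 3 * \<gamma> x"
  shows "\<exists>C\<ge>0. \<forall>\<phi>. energy_discriminant \<gamma> \<theta> \<phi> \<le> C * (sin (\<phi> - \<theta>))\<^sup>2"
proof -
  (* A period window chosen so that its only zeros of the sine are \<theta> and \<theta> + pi,
     both in the interior. *)
  let ?S = "{\<theta> - pi / 2..\<theta> - pi / 2 + 2 * pi}"
  have zeros: "\<phi> = \<theta> \<or> \<phi> = \<theta> + pi" if "\<phi> \<in> ?S" "sin (\<phi> - \<theta>) = 0" for \<phi>
  proof -
    obtain i :: int where i: "\<phi> - \<theta> = of_int i * pi"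
      using \<open>sin (\<phi> - \<theta>) = 0\<close> sin_zero_iff_int2 by blast
    have "- (pi / 2) \<le> \<phi> - \<theta>" "\<phi> - \<theta> \<le> 3 * pi / 2"
      using \<open>\<phi> \<in> ?S\<close> by auto
    then have "- 1 * pi < of_int i * pi" "of_int i * pi < 2 * pi"
      unfolding i using pi_gt_zero by linarith+
    then have "- 1 < real_of_int i" "real_of_int i < 2"
      by (simp_all only: mult_less_cancel_right_pos[OF pi_gt_zero])
    then have "i = 0 \<or> i = 1" by linarith
    then show ?thesis using i by auto
  qed
  have "\<exists>C\<ge>0. \<forall>\<phi>\<in>?S. energy_discriminant \<gamma> \<theta> \<phi> \<le> C * (sin (\<phi> - \<theta>))\<^sup>2"
  proof (rule dominated_by_square_on_compact)
    show "compact ?S" by simp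
    show "(energy_discriminant \<gamma> \<theta> has_real_derivative energy_discriminant_deriv \<gamma> \<theta> \<phi>) (at \<phi>)" for \<phi>
      by (rule DERIV_energy_discriminant[OF d])
    show "energy_discriminant_deriv \<gamma> \<theta> differentiable (at \<phi>)" for \<phi>
      by (rule energy_discriminant_deriv_differentiable[OF _ d2])
         (use d real_differentiable_def in blast)
    show "((\<lambda>\<phi>. sin (\<phi> - \<theta>)) has_real_derivative cos (\<phi> - \<theta>)) (at \<phi>)" for \<phi>
      by (auto intro!: derivative_eq_intros)
  next
    fix \<phi> assume S: "\<phi> \<in> ?S" and "sin (\<phi> - \<theta>) = 0"
    then have "\<phi> = \<theta> \<or> \<phi> = \<theta> + pi" by (rule zeros)
    then show "cos (\<phi> - \<theta>) \<noteq> 0" by auto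
    have "energy_discriminant \<gamma> \<theta> \<theta> \<le> 0"
      by (simp add: energy_discriminant_def power2_eq_square)
    with \<open>\<phi> = \<theta> \<or> \<phi> = \<theta> + pi\<close> show "energy_discriminant \<gamma> \<theta> \<phi> \<le> 0"
      using discriminant_nonpos_at_antipode[of \<gamma> \<theta>, OF pos pos ineq] by blast
  next
    fix \<phi> assume "\<phi> \<in> ?S" "sin (\<phi> - \<theta>) = 0" and 0: "energy_discriminant \<gamma> \<theta> \<phi> = 0"
    from zeros[OF this(1,2)] show "energy_discriminant_deriv \<gamma> \<theta> \<phi> = 0"
    proof
      assume "\<phi> = \<theta>"
      then show ?thesis by (simp add: energy_discriminant_deriv_def)
    next
      assume "\<phi> = \<theta> + pi"
      then show ?thesis
        using zero_discriminant_at_antipode[OF d pos ineq] 0 by simp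
    qed
  qed
  then obtain C where C: "C \<ge> 0"
    "\<And>\<phi>. \<phi> \<in> ?S \<Longrightarrow> energy_discriminant \<gamma> \<theta> \<phi> \<le> C * (sin (\<phi> - \<theta>))\<^sup>2"
    by blast
  have "torus_fun (energy_discriminant \<gamma> \<theta>)"
    by standard (rule energy_discriminant_periodic(1)[OF per deriv_torus_fun[OF per d]])
  moreover have "torus_fun (\<lambda>\<phi>. C * (sin (\<phi> - \<theta>))\<^sup>2)"
  proof
    fix x
    show "C * (sin (x + 2 * pi - \<theta>))\<^sup>2 = C * (sin (x - \<theta>))\<^sup>2"
      using sin_periodic[of "x - \<theta>"] by (simp add: algebra_simps)
  qed
  ultimately have "energy_discriminant \<gamma> \<theta> \<phi> \<le> C * (sin (\<phi> - \<theta>))\<^sup>2" for \<phi>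
    using C(2) by (rule torus_fun_bound_from_period)
  with C(1) show ?thesis by blast
qed

theorem theorem4p2:
  fixes \<gamma> :: "real \<Rightarrow> real"
  assumes "torus_fun \<gamma>"
    and "\<forall>\<theta>. 0 < \<gamma> \<theta>"
    and "C2_fun \<gamma>"
    and "\<forall>\<theta>. 3 * \<gamma> \<theta> - \<gamma> (\<theta> - pi) \<ge> 0"
  shows "\<exists>K :: real \<Rightarrow> real. torus_fun K \<and> (\<forall>\<theta>. 0 \<le> K \<theta>) \<and>
    (\<forall>k :: real \<Rightarrow> real. torus_fun k \<and> (\<forall>\<theta>. 0 \<le> k \<theta>) \<and> (\<forall>\<theta>. K \<theta> \<le> k \<theta>) \<longrightarrow>
      (\<forall>(p :: real^2) (q :: real^2) \<phi> \<theta>. p \<noteq> 0 \<and> q \<noteq> 0 \<and>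
         p = norm p *\<^sub>R vector [cos \<phi>, sin \<phi>] \<and> q = norm q *\<^sub>R vector [cos \<theta>, sin \<theta>] \<longrightarrow>
         1 / norm q * ((surface_energy_matrix \<gamma> k \<theta> *v p) \<bullet> (p - q))
           \<ge> \<gamma> \<phi> * norm p - \<gamma> \<theta> * norm q))"
proof -
  have pos: "\<And>x. 0 < \<gamma> x" using assms(2) by blast
  have d: "(\<gamma> has_real_derivative deriv \<gamma> x) (at x)" for x
    using assms(3) unfolding C2_fun_def differentiable_on_def
    by (metis DERIV_deriv_iff_real_differentiable UNIV_I)
  have d2: "deriv \<gamma> differentiable (at x)" for x
    using assms(3) unfolding C2_fun_def C1_differentiable_on_eq by blast
  have ineq: "\<gamma> (x + pi) \<le> 3 * \<gamma> x" for x
    using assms(4)[rule_format, of x] periodic_fun_simple.plus_period[OF assms(1), of "x - pi"]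
    by (simp add: algebra_simps)
  note per' = deriv_torus_fun[OF assms(1) d]
  define good where "good \<theta> C \<longleftrightarrow>
    0 \<le> C \<and> (\<forall>\<phi>. energy_discriminant \<gamma> \<theta> \<phi> \<le> C * (sin (\<phi> - \<theta>))\<^sup>2)" for \<theta> C
  have ex: "\<exists>C. good \<theta> C" for \<theta>
    unfolding good_def using energy_discriminant_dominated[OF assms(1) pos d d2 ineq] by blast
  (* The predicate depends on \<theta> only modulo the period, so a choice made from the predicate
     is automatically periodic. *)
  have good_period: "good (\<theta> + 2 * pi) = good \<theta>" for \<theta>
  proof -
    have "sin (\<phi> - (\<theta> + 2 * pi)) = sin (\<phi> - \<theta>)" for \<phi>
      by (simp add: diff_diff_eq [symmetric] sin_diff [of _ "2 * pi"])
    then show ?thesis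
      unfolding good_def energy_discriminant_periodic(2)[OF assms(1) per'] by simp
  qed
  define K where "K \<theta> = (SOME C. good \<theta> C) / (4 * \<gamma> \<theta>)" for \<theta>
  have good: "good \<theta> (4 * \<gamma> \<theta> * K \<theta>)" for \<theta>
    using someI_ex[OF ex] pos[of \<theta>] by (simp add: K_def)
  have "torus_fun K"
    by standard (simp add: K_def good_period periodic_fun_simple.plus_period[OF assms(1)])
  moreover have "0 \<le> K \<theta>" for \<theta>
    using good[of \<theta>] pos[of \<theta>] by (simp add: good_def zero_le_mult_iff)
  moreover have "\<gamma> \<phi> * norm p - \<gamma> \<theta> * norm q
      \<le> 1 / norm q * ((surface_energy_matrix \<gamma> k \<theta> *v p) \<bullet> (p - q))"
    if "K \<theta> \<le> k \<theta>" "q \<noteq> 0" "p = norm p *\<^sub>R vector [cos \<phi>, sin \<phi>]"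
      "q = norm q *\<^sub>R vector [cos \<theta>, sin \<theta>]" for k :: "real \<Rightarrow> real" and p q :: "real^2" and \<phi> \<theta>
  proof (rule energy_estimate_if_discriminant[OF pos _ that(2-4)])
    have "energy_discriminant \<gamma> \<theta> \<phi> \<le> 4 * \<gamma> \<theta> * K \<theta> * (sin (\<phi> - \<theta>))\<^sup>2"
      using good by (simp add: good_def)
    also have "\<dots> \<le> 4 * \<gamma> \<theta> * k \<theta> * (sin (\<phi> - \<theta>))\<^sup>2"
      using that(1) pos[of \<theta>] by (intro mult_right_mono mult_left_mono) auto
    finally show "energy_discriminant \<gamma> \<theta> \<phi> \<le> 4 * \<gamma> \<theta> * k \<theta> * (sin (\<phi> - \<theta>))\<^sup>2" .
  qed
  ultimately show ?thesis by blast
qed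

end
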